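(* Let $\gamma\in\{\sum_j C_j,\ \sum_j w_jC_j,\ C_{\max}\}$ and $\alpha\ge 1$. Let $\pi$ be a policy for Flow Shop Scheduling with Stochastic Reentry (defined for every instance). Suppose that for every instance $I$ and every $k\in\{1,\dots,m\}$ the policy $\pi_k$ induced by $\pi$ on the auxiliary instance $I_k$ satisfies $\mathbb{E}[\gamma(\pi_k)]\le\alpha\,\mathbb{E}[\gamma(\mathrm{OPT}(I_k))]$. Then $\pi$ is an $\alpha$-approximation for Flow Shop Scheduling with Stochastic Reentry with objective $\gamma$.
   Context: Flow Shop Scheduling with Stochastic Reentry: there are machines $1,\dots,m$ and jobs $1,\dots,n$ with positive weights $w_j$; job $j$ requires $Y_j$ passes ("loops") through machines $1,2,\dots,m$ in this order, where $Y_1,\dots,Y_n$ are independent positive-integer-valued random variables whose distributions are known but whose realizations are not. Every operation takes unit time. A loop started on machine $1$ at integer time $\tau$ is processed on machine $i$ during $[\tau+i-1,\tau+i)$ and completes at $\tau+m$; at most one loop may start at each integer time, and the loops of a job are processed one after another. The completion time $C_j$ is the completion time of the $Y_j$-th loop of job $j$, and $C_{\max}=\max_j C_j$. A policy decides at each integer time either to start a loop of some uncompleted job not currently in a loop, or nothing; it is non-anticipatory (decisions may depend on the instance, the current time and the past, but not on realizations of the $Y_j$ of uncompleted jobs). $\mathrm{OPT}(I)$ denotes a policy minimizing the expected objective value on $I$. A policy $\pi$ is an $\alpha$-approximation if $\mathbb{E}[\gamma(\pi(I))]\le\alpha\,\mathbb{E}[\gamma(\mathrm{OPT}(I))]$ for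 all instances $I$. Stochastic Scheduling with Machine Arrivals: $m$ identical parallel machines, machine $i$ may only be used from its arrival time $a_i$ on; jobs with random processing times $X_j$ and weights $w_j$; each machine processes at most one job at a time, each job is processed by at most one machine at a time, and $C_j$ is the time at which job $j$ has received $X_j$ units of processing. $\mathrm{OPT}(I_k)$ denotes a feasible non-anticipatory policy minimizing the expected objective on $I_k$. Auxiliary instances: for $k\in\{1,\dots,m\}$, $I_k$ is the instance of Stochastic Scheduling with Machine Arrivals with $m$ machines, a job $j$ with processing time $X_j=Y_j$ and weight $w_j$ for every job $j$ of $I$, and arrival times $a_i^k=0$ if $i+k\le m+1$ and $a_i^k=1$ otherwise. Induced policy: given a policy $\pi$ for $I$, whenever $\pi$ starts a loop of job $j$ (or idles) at time $\tau=mt+i-1$ with $t=\lfloor\tau/m\rfloor$, $i=(\tau\bmod m)+1$, the induced policy $\pi_k$ processes job $j$ (or idles) on machine $i$ during $[t+a_i^k,t+a_i^k+1)$. *)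

theory Defs
  imports "HOL-Probability.Probability"
begin

datatype objective = Total_Completion | Weighted_Completion | Makespan

(* Completion times are ennreal-valued: a job that a policy never finishes has C_j = \<infinity>. *)
fun objective_value :: "objective \<Rightarrow> nat \<Rightarrow> (nat \<Rightarrow> real) \<Rightarrow> (nat \<Rightarrow> ennreal) \<Rightarrow> ennreal" where
  "objective_value Total_Completion n w C = (\<Sum>j\<in>{1..n}. C j)"
| "objective_value Weighted_Completion n w C = (\<Sum>j\<in>{1..n}. ennreal (w j) * C j)"
| "objective_value Makespan n w C = Max (C ` {1..n})"


section \<open>Flow shop scheduling with stochastic reentry\<close>

record fs_instance =
  fs_machines :: nat
  fs_jobs :: nat
  fs_weight :: "nat \<Rightarrow> real"
  fs_loops :: "nat \<Rightarrow> nat pmf"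

definition fs_valid :: "fs_instance \<Rightarrow> bool" where
  "fs_valid I \<longleftrightarrow> 1 \<le> fs_machines I \<and> 1 \<le> fs_jobs I \<and>
     (\<forall>j\<in>{1..fs_jobs I}. 0 < fs_weight I j \<and> 0 \<notin> set_pmf (fs_loops I j))"

(* Joint law of the independent loop counts (0 outside the index set {1..n}). *)
definition fs_law :: "fs_instance \<Rightarrow> (nat \<Rightarrow> nat) pmf" where
  "fs_law I = Pi_pmf {1..fs_jobs I} 0 (fs_loops I)"

(* A policy for a fixed instance sees the chronological list of its earlier decisions, whose length
   is the current time, and the set of jobs completed by now.  This is the whole observable past:
   the completion time and the number of loops of a completed job can be read off the list. *)
type_synonym fs_decision_rule = "nat option list \<Rightarrow> nat set \<Rightarrow> nat option"

(* Jobs all of whose loops have left the last machine by time length h. *)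
definition fs_completed :: "fs_instance \<Rightarrow> (nat \<Rightarrow> nat) \<Rightarrow> nat option list \<Rightarrow> nat set" where
  "fs_completed I y h =
     {j \<in> {1..fs_jobs I}. y j \<le> card {s. s + fs_machines I \<le> length h \<and> h ! s = Some j}}"

primrec fs_history ::
  "fs_instance \<Rightarrow> fs_decision_rule \<Rightarrow> (nat \<Rightarrow> nat) \<Rightarrow> nat \<Rightarrow> nat option list" where
  "fs_history I p y 0 = []"
| "fs_history I p y (Suc \<tau>) =
     fs_history I p y \<tau> @ [p (fs_history I p y \<tau>) (fs_completed I y (fs_history I p y \<tau>))]"

definition fs_decision ::
  "fs_instance \<Rightarrow> fs_decision_rule \<Rightarrow> (nat \<Rightarrow> nat) \<Rightarrow> nat \<Rightarrow> nat option" where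
  "fs_decision I p y \<tau> = p (fs_history I p y \<tau>) (fs_completed I y (fs_history I p y \<tau>))"

(* Only uncompleted jobs that are not currently in a loop may be started. *)
definition fs_policy :: "fs_instance \<Rightarrow> fs_decision_rule \<Rightarrow> bool" where
  "fs_policy I p \<longleftrightarrow> (\<forall>y\<in>set_pmf (fs_law I). \<forall>\<tau> j. fs_decision I p y \<tau> = Some j \<longrightarrow>
     j \<in> {1..fs_jobs I} \<and>
     j \<notin> fs_completed I y (fs_history I p y \<tau>) \<and>
     (\<forall>s<\<tau>. fs_decision I p y s = Some j \<longrightarrow> s + fs_machines I \<le> \<tau>))"

(* At most one s satisfies the condition, namely the start of the (y j)-th loop of job j;
   if there is none, the infimum is \<infinity>. *)
definition fs_completion ::
  "fs_instance \<Rightarrow> fs_decision_rule \<Rightarrow> (nat \<Rightarrow> nat) \<Rightarrow> nat \<Rightarrow> ennreal" where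
  "fs_completion I p y j =
     (INF s\<in>{s. fs_decision I p y s = Some j \<and>
                card {s'. s' \<le> s \<and> fs_decision I p y s' = Some j} = y j}.
        of_nat (s + fs_machines I))"

definition fs_cost :: "objective \<Rightarrow> fs_instance \<Rightarrow> fs_decision_rule \<Rightarrow> ennreal" where
  "fs_cost \<gamma> I p =
     (\<integral>\<^sup>+ y. objective_value \<gamma> (fs_jobs I) (fs_weight I) (fs_completion I p y) \<partial>measure_pmf (fs_law I))"

(* Expected objective of OPT(I), see fs_opt_eq. *)
definition fs_opt :: "objective \<Rightarrow> fs_instance \<Rightarrow> ennreal" where
  "fs_opt \<gamma> I = (INF p\<in>{p. fs_policy I p}. fs_cost \<gamma> I p)"

lemma fs_opt_eq:
  assumes "fs_policy I p" and "\<And>q. fs_policy I q \<Longrightarrow> fs_cost \<gamma> I p \<le> fs_cost \<gamma> I q"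
  shows "fs_opt \<gamma> I = fs_cost \<gamma> I p"
  unfolding fs_opt_def using assms by (intro antisym INF_lower INF_greatest) auto

definition fs_approximation ::
  "objective \<Rightarrow> real \<Rightarrow> (fs_instance \<Rightarrow> fs_decision_rule) \<Rightarrow> bool" where
  "fs_approximation \<gamma> \<alpha> \<pi> \<longleftrightarrow>
     (\<forall>I. fs_valid I \<longrightarrow> fs_policy I (\<pi> I) \<and> fs_cost \<gamma> I (\<pi> I) \<le> ennreal \<alpha> * fs_opt \<gamma> I)"


section \<open>Stochastic scheduling with machine arrivals\<close>

record ma_instance =
  ma_machines :: nat
  ma_arrival :: "nat \<Rightarrow> real"
  ma_jobs :: nat
  ma_weight :: "nat \<Rightarrow> real"
  ma_ptime :: "nat \<Rightarrow> real pmf"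

definition ma_law :: "ma_instance \<Rightarrow> (nat \<Rightarrow> real) pmf" where
  "ma_law I = Pi_pmf {1..ma_jobs I} 0 (ma_ptime I)"

(* S i s is the job processed by machine i at time s, so a machine never processes two jobs. *)
type_synonym ma_schedule = "nat \<Rightarrow> real \<Rightarrow> nat option"

(* The schedule that arises under a given realization of the processing times; that it arises
   without foresight is the condition ma_nonanticipatory. *)
type_synonym ma_rule = "(nat \<Rightarrow> real) \<Rightarrow> ma_schedule"

definition ma_feasible :: "ma_instance \<Rightarrow> ma_schedule \<Rightarrow> bool" where
  "ma_feasible I S \<longleftrightarrow>
     (\<forall>i\<in>{1..ma_machines I}. \<forall>s\<ge>0. \<forall>j. S i s = Some j \<longrightarrow>
        ma_arrival I i \<le> s \<and> j \<in> {1..ma_jobs I} \<and>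
        (\<forall>i'\<in>{1..ma_machines I}. S i' s = Some j \<longrightarrow> i' = i)) \<and>
     (\<forall>i\<in>{1..ma_machines I}. \<forall>j. {s. 0 \<le> s \<and> S i s = Some j} \<in> sets borel)"

definition ma_received :: "ma_instance \<Rightarrow> ma_schedule \<Rightarrow> nat \<Rightarrow> real \<Rightarrow> ennreal" where
  "ma_received I S j t =
     emeasure lborel {s. 0 \<le> s \<and> s < t \<and> (\<exists>i\<in>{1..ma_machines I}. S i s = Some j)}"

definition ma_completion :: "ma_instance \<Rightarrow> ma_rule \<Rightarrow> (nat \<Rightarrow> real) \<Rightarrow> nat \<Rightarrow> ennreal" where
  "ma_completion I \<sigma> x j = (INF t\<in>{t. 0 \<le> t \<and> ennreal (x j) \<le> ma_received I (\<sigma> x) j t}. ennreal t)"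

(* Two realizations with the same completions up to time t cannot be told apart at time t. *)
definition ma_nonanticipatory :: "ma_instance \<Rightarrow> ma_rule \<Rightarrow> bool" where
  "ma_nonanticipatory I \<sigma> \<longleftrightarrow>
     (\<forall>x\<in>set_pmf (ma_law I). \<forall>x'\<in>set_pmf (ma_law I). \<forall>t\<ge>0.
        (\<forall>j\<in>{1..ma_jobs I}.
           (x j = x' j \<and> ma_completion I \<sigma> x j = ma_completion I \<sigma> x' j) \<or>
           (ennreal t < ma_completion I \<sigma> x j \<and> ennreal t < ma_completion I \<sigma> x' j)) \<longrightarrow>
        (\<forall>i\<in>{1..ma_machines I}. \<sigma> x i t = \<sigma> x' i t))"

(* Jobs may be preempted and moved to another machine, either at any real time or only at integer
   times. *)
datatype preemption = Any_Time | Integer_Times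

definition ma_policy :: "preemption \<Rightarrow> ma_instance \<Rightarrow> ma_rule \<Rightarrow> bool" where
  "ma_policy \<mu> I \<sigma> \<longleftrightarrow>
     (\<forall>x\<in>set_pmf (ma_law I). ma_feasible I (\<sigma> x)) \<and>
     ma_nonanticipatory I \<sigma> \<and>
     (\<mu> = Integer_Times \<longrightarrow>
        (\<forall>x\<in>set_pmf (ma_law I). \<forall>i\<in>{1..ma_machines I}. \<forall>s\<ge>0. \<sigma> x i s = \<sigma> x i (of_int \<lfloor>s\<rfloor>)))"

definition ma_cost :: "objective \<Rightarrow> ma_instance \<Rightarrow> ma_rule \<Rightarrow> ennreal" where
  "ma_cost \<gamma> I \<sigma> =
     (\<integral>\<^sup>+ x. objective_value \<gamma> (ma_jobs I) (ma_weight I) (ma_completion I \<sigma> x) \<partial>measure_pmf (ma_law I))"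

(* Expected objective of OPT, see ma_opt_eq. *)
definition ma_opt :: "preemption \<Rightarrow> objective \<Rightarrow> ma_instance \<Rightarrow> ennreal" where
  "ma_opt \<mu> \<gamma> I = (INF \<sigma>\<in>{\<sigma>. ma_policy \<mu> I \<sigma>}. ma_cost \<gamma> I \<sigma>)"

lemma ma_opt_eq:
  assumes "ma_policy \<mu> I \<sigma>" and "\<And>\<rho>. ma_policy \<mu> I \<rho> \<Longrightarrow> ma_cost \<gamma> I \<sigma> \<le> ma_cost \<gamma> I \<rho>"
  shows "ma_opt \<mu> \<gamma> I = ma_cost \<gamma> I \<sigma>"
  unfolding ma_opt_def using assms by (intro antisym INF_lower INF_greatest) auto


section \<open>Auxiliary instances and induced policies\<close>

definition aux_arrival :: "nat \<Rightarrow> nat \<Rightarrow> nat \<Rightarrow> real" where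
  "aux_arrival m k i = (if i + k \<le> m + 1 then 0 else 1)"

definition aux_instance :: "fs_instance \<Rightarrow> nat \<Rightarrow> ma_instance" where
  "aux_instance I k =
     \<lparr> ma_machines = fs_machines I,
       ma_arrival = aux_arrival (fs_machines I) k,
       ma_jobs = fs_jobs I,
       ma_weight = fs_weight I,
       ma_ptime = (\<lambda>j. map_pmf real (fs_loops I j)) \<rparr>"

(* For s in [t + a, t + a + 1), where a is the arrival time of machine i, the floor of s - a is t,
   so machine i executes the decision taken at time m t + i - 1.  A realization x of the auxiliary
   instance is integral; the floor only converts it back to a realization of the loop counts. *)
definition induced_policy :: "fs_instance \<Rightarrow> fs_decision_rule \<Rightarrow> nat \<Rightarrow> ma_rule" where
  "induced_policy I p k x i s =
     (let a = aux_arrival (fs_machines I) k i in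
      if a \<le> s
      then fs_decision I p (\<lambda>j. nat \<lfloor>x j\<rfloor>) (fs_machines I * nat \<lfloor>s - a\<rfloor> + i - 1)
      else None)"

end

theory Submission
  imports Defs
begin

text \<open>
  A loop started at time \<open>\<tau>\<close> is executed by the \<open>k\<close>-th induced policy in the unit slot with number
  \<open>(\<tau> + k - 1) div m\<close>. By Hermite's identity these slot numbers sum to \<open>\<tau>\<close> over \<open>k = 1, \<dots>, m\<close>, so the
  completion time of a job in the flow shop is the sum of its completion times under the \<open>m\<close> induced
  policies. The slot number is monotone in \<open>\<tau>\<close>, so the last job is the same in all instances and
  the decomposition carries over to the makespan. As an arbitrary flow shop policy induces feasible
  non-anticipatory policies, the sum of the auxiliary optima is a lower bound for the flow shop
  optimum.
\<close>

section \<open>Elements of given rank in a set of naturals\<close>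

text \<open>The element of rank \<open>n\<close>, kept as a set: it has at most one element
  (\<open>ranked_unique\<close>), and an infimum over it is \<infinity> when there is none. For the
  start times of a job and its loop count, it holds the start of the last loop.\<close>

definition ranked :: "nat set \<Rightarrow> nat \<Rightarrow> nat set" where
  "ranked A n = {a \<in> A. card {a' \<in> A. a' \<le> a} = n}"

text \<open>The number of elements below \<open>M\<close> grows by at most one as \<open>M\<close>
  increases by one, so the least \<open>M\<close> at which it reaches \<open>n\<close> attains
  \<open>n\<close> exactly, and \<open>M - 1\<close> is the element sought.\<close>

lemma ranked_exists:
  assumes "1 \<le> n" and "n \<le> card {a \<in> A. a < N}"
  obtains a where "a \<in> ranked A n" and "a < N"
proof -
  define F where "F M = card {a \<in> A. a < M}" for M
  define M where "M = (LEAST M. n \<le> F M)"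
  have M: "n \<le> F M" "M \<le> N"
    using assms(2) unfolding M_def F_def[symmetric] by (auto intro: LeastI Least_le)
  have "F 0 = 0" by (simp add: F_def)
  then obtain a where a: "M = Suc a" using M(1) assms(1) by (cases M) auto
  have lt: "F a < n" using not_less_Least[of a "\<lambda>M. n \<le> F M"] a by (simp add: M_def)
  have step: "{b \<in> A. b < Suc a} = {b \<in> A. b < a} \<union> (if a \<in> A then {a} else {})"
    by (auto simp: less_Suc_eq)
  have F: "F (Suc a) = F a + (if a \<in> A then 1 else 0)"
    unfolding F_def step by auto
  then have "a \<in> A" "F (Suc a) = n" using lt M(1) a by (auto split: if_splits)
  then have "a \<in> ranked A n" by (simp add: ranked_def F_def less_Suc_eq_le)
  then show thesis using that M(2) a by simp
qed

lemma ranked_unique: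
  assumes "a \<in> ranked A n" and "b \<in> ranked A n"
  shows "a = b"
proof -
  have less: False if "a \<in> ranked A n" "b \<in> ranked A n" "a < b" for a b
  proof -
    have "b \<in> A" using that(2) by (simp add: ranked_def)
    then have "b \<in> {c \<in> A. c \<le> b} - {c \<in> A. c \<le> a}" using that(3) by simp
    moreover have "{c \<in> A. c \<le> a} \<subseteq> {c \<in> A. c \<le> b}" using that(3) by auto
    ultimately have "{c \<in> A. c \<le> a} \<subset> {c \<in> A. c \<le> b}" by blast
    then have "card {c \<in> A. c \<le> a} < card {c \<in> A. c \<le> b}" by (intro psubset_card_mono) auto
    then show False using that by (simp add: ranked_def)
  qed
  show ?thesis using less[OF assms] less[OF assms(2,1)] by (cases a b rule: linorder_cases) auto
qed

text \<open>A strictly increasing map is an order isomorphism onto its image and so keeps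
  ranks.\<close>

lemma ranked_image:
  assumes "strict_mono_on A f"
  shows "ranked (f ` A) n = f ` ranked A n"
proof -
  have "card {b \<in> f ` A. b \<le> f a} = card {a' \<in> A. a' \<le> a}" if "a \<in> A" for a
  proof -
    have "{b \<in> f ` A. b \<le> f a} = f ` {a' \<in> A. a' \<le> a}"
      using strict_mono_on_less_eq[OF assms] that by auto
    moreover have "inj_on f {a' \<in> A. a' \<le> a}"
      using strict_mono_on_imp_inj_on[OF assms] by (rule inj_on_subset) auto
    ultimately show ?thesis by (simp add: card_image)
  qed
  then show ?thesis by (auto simp: ranked_def)
qed


section \<open>Processing in unit slots\<close>

lemma slots_eq_UN:
  "{s::real. 0 \<le> s \<and> nat \<lfloor>s\<rfloor> \<in> A} = (\<Union>a\<in>A. {real a..<real a + 1})"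
proof -
  have "s \<in> {real a..<real a + 1} \<longleftrightarrow> 0 \<le> s \<and> nat \<lfloor>s\<rfloor> = a" for a and s :: real
    by (simp, linarith)
  then show ?thesis by (simp only: set_eq_iff UN_iff mem_Collect_eq) blast
qed

lemma slots_borel: "{s::real. 0 \<le> s \<and> nat \<lfloor>s\<rfloor> \<in> A} \<in> sets borel"
  unfolding slots_eq_UN by auto

lemma emeasure_slots:
  assumes "finite A"
  shows "emeasure lborel (\<Union>a\<in>A. {real a..<real a + 1}) = of_nat (card A)"
proof -
  have "disjoint_family_on (\<lambda>a. {real a..<real a + 1}) A"
    by (auto simp: disjoint_family_on_def)
  then have "emeasure lborel (\<Union>a\<in>A. {real a..<real a + 1})
      = (\<Sum>a\<in>A. emeasure lborel {real a..<real a + 1})"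
    using assms by (intro sum_emeasure[symmetric]) auto
  then show ?thesis by simp
qed

text \<open>If processing fills whole unit slots, the \<open>n\<close>-th unit is complete exactly
  at the end of the \<open>n\<close>-th slot used. For \<open>n = 0\<close> the two sides would
  differ: the left one is 0, the right one an infimum over the empty set.\<close>

lemma INF_time_received:
  fixes A :: "nat set"
  assumes "1 \<le> n"
  shows "(INF t\<in>{t. 0 \<le> t \<and>
            of_nat n \<le> emeasure lborel {s. 0 \<le> s \<and> s < t \<and> nat \<lfloor>s\<rfloor> \<in> A}}. ennreal t)
       = (INF a\<in>ranked A n. of_nat (a + 1))"
    (is "Inf (ennreal ` ?T) = _")
proof (rule antisym)
  show "Inf (ennreal ` ?T) \<le> (INF a\<in>ranked A n. of_nat (a + 1))"
  proof (rule INF_greatest)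
    fix a assume "a \<in> ranked A n"
    then have n: "card {a' \<in> A. a' \<le> a} = n" by (simp add: ranked_def)
    have "{s. 0 \<le> s \<and> s < real (a + 1) \<and> nat \<lfloor>s\<rfloor> \<in> A}
        = {s. 0 \<le> s \<and> nat \<lfloor>s\<rfloor> \<in> {a' \<in> A. a' \<le> a}}"
    proof -
      have "s < real (a + 1) \<longleftrightarrow> nat \<lfloor>s\<rfloor> \<le> a" if "0 \<le> s" for s :: real
        using that by linarith
      then show ?thesis by auto
    qed
    then have "emeasure lborel {s. 0 \<le> s \<and> s < real (a + 1) \<and> nat \<lfloor>s\<rfloor> \<in> A} = of_nat n"
      using emeasure_slots[of "{a' \<in> A. a' \<le> a}"] n by (simp only: slots_eq_UN) simp
    then have "real (a + 1) \<in> ?T" by (simp only: mem_Collect_eq order_refl) simp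
    then have "Inf (ennreal ` ?T) \<le> ennreal (real (a + 1))" by (rule INF_lower)
    then show "Inf (ennreal ` ?T) \<le> of_nat (a + 1)" by (simp only: ennreal_of_nat_eq_real_of_nat)
  qed
next
  show "(INF a\<in>ranked A n. of_nat (a + 1)) \<le> Inf (ennreal ` ?T)"
  proof (rule INF_greatest)
    fix t assume t: "t \<in> ?T"
    \<comment> \<open>\<open>N\<close> slots have ended by time \<open>t\<close>; the slot in
      progress adds at most \<open>t - N < 1\<close>.\<close>
    define N where "N = nat \<lfloor>t\<rfloor>"
    have N: "real N \<le> t" "t < real N + 1" using t unfolding N_def by auto
    let ?U = "\<Union>a\<in>{a \<in> A. a < N}. {real a..<real a + 1}"
    have "{s. 0 \<le> s \<and> s < t \<and> nat \<lfloor>s\<rfloor> \<in> A} \<subseteq> ?U \<union> {real N..<t}"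
    proof
      fix s assume s: "s \<in> {s. 0 \<le> s \<and> s < t \<and> nat \<lfloor>s\<rfloor> \<in> A}"
      show "s \<in> ?U \<union> {real N..<t}"
      proof (cases "real N \<le> s")
        case False
        then have "nat \<lfloor>s\<rfloor> < N" using s by simp linarith
        moreover have "real (nat \<lfloor>s\<rfloor>) \<le> s" "s < real (nat \<lfloor>s\<rfloor>) + 1" using s by auto
        ultimately show ?thesis using s by auto
      qed (use s in auto)
    qed
    then have "emeasure lborel {s. 0 \<le> s \<and> s < t \<and> nat \<lfloor>s\<rfloor> \<in> A} \<le> emeasure lborel (?U \<union> {real N..<t})"
      by (intro emeasure_mono) auto
    also have "\<dots> \<le> emeasure lborel ?U + emeasure lborel {real N..<t}"
      by (intro emeasure_subadditive) auto
    also have "\<dots> = of_nat (card {a \<in> A. a < N}) + ennreal (t - real N)"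
      using N by (simp add: emeasure_slots)
    also have "\<dots> = ennreal (real (card {a \<in> A. a < N}) + (t - real N))"
      using N by (simp add: ennreal_of_nat_eq_real_of_nat)
    finally have "of_nat n \<le> ennreal (real (card {a \<in> A. a < N}) + (t - real N))"
      using t by (auto intro: order_trans)
    then have "ennreal (real n) \<le> ennreal (real (card {a \<in> A. a < N}) + (t - real N))"
      by (simp only: ennreal_of_nat_eq_real_of_nat)
    then have "real n \<le> real (card {a \<in> A. a < N}) + (t - real N)"
      using N by (subst (asm) ennreal_le_iff) auto
    \<comment> \<open>The partial slot contributes less than one unit, so by integrality all
      \<open>n\<close> units lie in slots that end by time \<open>N\<close>.\<close>
    then have "n \<le> card {a \<in> A. a < N}" using N by linarith
    from ranked_exists[OF assms this] obtain a where a: "a \<in> ranked A n" "a < N" .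
    have "(INF a\<in>ranked A n. of_nat (a + 1)) \<le> (of_nat (a + 1) :: ennreal)"
      using a(1) by (rule INF_lower)
    also have "\<dots> \<le> ennreal t"
      unfolding ennreal_of_nat_eq_real_of_nat using a(2) N by (intro ennreal_leI) linarith
    finally show "(INF a\<in>ranked A n. of_nat (a + 1)) \<le> ennreal t" .
  qed
qed


section \<open>Slot numbers\<close>

text \<open>The slot in which the \<open>k\<close>-th induced policy executes the decision taken at
  time \<tau>; \<open>slot_eq\<close> confirms this as \<open>t\<close> plus the arrival time of the
  machine.\<close>

definition slot :: "nat \<Rightarrow> nat \<Rightarrow> nat \<Rightarrow> nat" where
  "slot m k \<tau> = (\<tau> + k - 1) div m"

lemma slot_mono: "\<tau> \<le> \<tau>' \<Longrightarrow> slot m k \<tau> \<le> slot m k \<tau>'"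
  unfolding slot_def by (intro div_le_mono) auto

lemma slot_add:
  assumes "1 \<le> m" and "1 \<le> k"
  shows "slot m k (\<tau> + m) = slot m k \<tau> + 1"
proof -
  have "\<tau> + m + k - 1 = (\<tau> + k - 1) + m" using assms by simp
  then show ?thesis using assms unfolding slot_def by (simp only: div_add_self2)
qed

text \<open>Hermite's identity. Passing from \<tau> to \<open>Suc \<tau>\<close> shifts the index
  \<open>k\<close> by one: the term for \<open>k = 1\<close> leaves and the term for
  \<open>k = m + 1\<close>, larger by one, enters.\<close>

lemma sum_slot: "(\<Sum>k=1..m. slot m k \<tau>) = \<tau>" if "1 \<le> m"
proof (induction \<tau>)
  case 0
  have "slot m k 0 = 0" if "k \<in> {1..m}" for k
    using that by (auto simp: slot_def)
  then show ?case by simp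
next
  case (Suc \<tau>)
  have "slot m k (Suc \<tau>) = slot m (Suc k) \<tau>" for k by (simp add: slot_def)
  then have "(\<Sum>k=1..m. slot m k (Suc \<tau>)) = (\<Sum>k=1..m. slot m (Suc k) \<tau>)" by simp
  also have "\<dots> = (\<Sum>k=Suc 1..Suc m. slot m k \<tau>)"
    by (rule sum.shift_bounds_cl_Suc_ivl[symmetric])
  \<comment> \<open>From here the chain carries the extra summand \<open>slot m 1 \<tau>\<close> on
    its left; it cancels at the end.\<close>
  also have "slot m 1 \<tau> + \<dots> = (\<Sum>k=1..Suc m. slot m k \<tau>)"
    by (rule sum.atLeast_Suc_atMost[symmetric]) simp
  also have "\<dots> = (\<Sum>k=1..m. slot m k \<tau>) + slot m (Suc m) \<tau>" by simp
  also have "slot m (Suc m) \<tau> = slot m 1 \<tau> + 1" using that by (simp add: slot_def)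
  finally show ?case using Suc.IH by simp
qed

lemma slot_eq:
  assumes "i \<in> {1..m}" and "k \<in> {1..m}"
  shows "slot m k (m * t + i - 1) = (if i + k \<le> m + 1 then t else t + 1)"
proof (cases "i + k \<le> m + 1")
  case True
  have "m * t + i - 1 + k - 1 = m * t + (i + k - 2)" using assms by auto
  moreover have "i + k - 2 < m" using True assms by auto
  ultimately show ?thesis using True by (simp add: slot_def)
next
  case False
  \<comment> \<open>Here \<open>i + k - 2\<close> lies between \<open>m\<close> and
    \<open>2 * m - 2\<close>, so it carries into the next slot with remainder
    \<open>r\<close>.\<close>
  define r where "r = i + k - m - 2"
  have r: "i + k = r + m + 2" using False unfolding r_def by linarith
  have "m * t + i - 1 + k - 1 = m * t + (i + k - 2)" using assms by auto
  also have "\<dots> = r + m * (t + 1)" using r by (simp add: algebra_simps)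
  finally have "slot m k (m * t + i - 1) = (r + m * (t + 1)) div m" by (simp add: slot_def)
  moreover have "r < m" using r assms by auto
  then have "(r + m * (t + 1)) div m = t + 1" by (simp only: div_mult_self2) simp
  ultimately show ?thesis using False by simp
qed


section \<open>Induced policies\<close>

lemma induced_policy_floor:
  assumes "0 \<le> s"
  shows "induced_policy I p k x i s =
    (let d = fs_decision I p (\<lambda>j. nat \<lfloor>x j\<rfloor>); m = fs_machines I; t = nat \<lfloor>s\<rfloor> in
     if i + k \<le> m + 1 then d (m * t + i - 1)
     else if t = 0 then None else d (m * (t - 1) + i - 1))"
proof -
  have "1 \<le> s \<longleftrightarrow> nat \<lfloor>s\<rfloor> \<noteq> 0" using assms by linarith
  moreover have "nat \<lfloor>s - 1\<rfloor> = nat \<lfloor>s\<rfloor> - 1" by linarith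
  ultimately show ?thesis
    using assms by (simp add: induced_policy_def aux_arrival_def Let_def)
qed

text \<open>Division with remainder by \<open>m\<close> makes every time \<tau> uniquely of the form
  \<open>m * t + i - 1\<close>; the remainder gives the machine and \<open>slot\<close> gives the
  unit interval.\<close>

lemma induced_policy_eq_Some_iff:
  assumes "0 \<le> s" and i: "i \<in> {1..fs_machines I}" and k: "k \<in> {1..fs_machines I}"
  shows "induced_policy I p k x i s = Some j \<longleftrightarrow>
    (\<exists>\<tau>. fs_decision I p (\<lambda>j. nat \<lfloor>x j\<rfloor>) \<tau> = Some j \<and> \<tau> mod fs_machines I + 1 = i \<and>
         slot (fs_machines I) k \<tau> = nat \<lfloor>s\<rfloor>)"
proof -
  let ?m = "fs_machines I"
  define d where "d = fs_decision I p (\<lambda>j. nat \<lfloor>x j\<rfloor>)"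
  have mod: "(?m * t + i - 1) mod ?m + 1 = i" for t
  proof -
    have "?m * t + i - 1 = (i - 1) + ?m * t" "i - 1 < ?m" using i by auto
    then have "(?m * t + i - 1) mod ?m = i - 1" by (simp del: add_diff_assoc)
    then show ?thesis using i by simp
  qed
  have "(\<exists>\<tau>. d \<tau> = Some j \<and> \<tau> mod ?m + 1 = i \<and> slot ?m k \<tau> = T) \<longleftrightarrow>
        (\<exists>t. d (?m * t + i - 1) = Some j \<and> slot ?m k (?m * t + i - 1) = T)" for T
  proof
    assume "\<exists>\<tau>. d \<tau> = Some j \<and> \<tau> mod ?m + 1 = i \<and> slot ?m k \<tau> = T"
    then obtain \<tau> where \<tau>: "d \<tau> = Some j" "\<tau> mod ?m + 1 = i" "slot ?m k \<tau> = T" by auto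
    have "\<tau> = ?m * (\<tau> div ?m) + i - 1" using \<tau>(2) by (metis add_diff_cancel_right' add.assoc mult_div_mod_eq)
    then show "\<exists>t. d (?m * t + i - 1) = Some j \<and> slot ?m k (?m * t + i - 1) = T"
      using \<tau> by metis
  qed (use mod in blast)
  \<comment> \<open>By \<open>slot_eq\<close>, slot \<open>T\<close> can only execute the round
    \<open>t = T\<close>, or \<open>t = T - 1\<close> on a machine arriving at time 1, which
    therefore idles in slot 0.\<close>
  moreover have "(\<exists>t. d (?m * t + i - 1) = Some j \<and> slot ?m k (?m * t + i - 1) = T) \<longleftrightarrow>
    (if i + k \<le> ?m + 1 then d (?m * T + i - 1)
     else if T = 0 then None else d (?m * (T - 1) + i - 1)) = Some j" for T
    using slot_eq[OF i k] by (cases T) auto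
  ultimately show ?thesis
    using assms(1) by (simp add: induced_policy_floor d_def Let_def)
qed

section \<open>Observable past and joint law of the realizations\<close>

lemma fs_history_eq_map: "fs_history I p y \<tau> = map (fs_decision I p y) [0..<\<tau>]"
  by (induction \<tau>) (auto simp: fs_decision_def)

lemma fs_completed_history:
  "fs_completed I y (fs_history I p y \<tau>) = {j \<in> {1..fs_jobs I}.
     y j \<le> card {s. s + fs_machines I \<le> \<tau> \<and> fs_decision I p y s = Some j}}"
    if "1 \<le> fs_machines I"
proof -
  \<comment> \<open>With at least one machine, \<open>s < \<tau>\<close>, so \<open>s\<close> is a
    valid index into the history.\<close>
  have "{s. s + fs_machines I \<le> \<tau> \<and> fs_history I p y \<tau> ! s = Some j}
      = {s. s + fs_machines I \<le> \<tau> \<and> fs_decision I p y s = Some j}" for j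
    using that by (auto simp: fs_history_eq_map)
  then show ?thesis by (simp add: fs_completed_def fs_history_eq_map[of I p y \<tau>])
qed

lemma fs_law_range:
  assumes "fs_valid I" and "y \<in> set_pmf (fs_law I)" and "j \<in> {1..fs_jobs I}"
  shows "1 \<le> y j"
proof -
  have "y j \<in> set_pmf (fs_loops I j)"
    using assms by (auto simp: fs_law_def set_Pi_pmf PiE_dflt_def)
  then show ?thesis using assms by (metis One_nat_def fs_valid_def not_less_eq_eq le_zero_eq)
qed

text \<open>Couples the two models: each realization of an auxiliary instance is
  \<open>real \<circ> y\<close> for a realization \<open>y\<close> of the loop counts. The default 0
  of the product law is preserved by \<open>real\<close>.\<close>

lemma aux_law: "ma_law (aux_instance I k) = map_pmf (\<lambda>y. real \<circ> y) (fs_law I)"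
  unfolding ma_law_def fs_law_def aux_instance_def by (simp add: Pi_pmf_map[where dflt = 0])

text \<open>The policy \<open>p\<close> is arbitrary because the results are applied both to the
  given policy and to every competitor in the flow shop optimum.\<close>

locale reentry_policy =
  fixes I :: fs_instance and p :: fs_decision_rule
  assumes valid: "fs_valid I" and policy: "fs_policy I p"
begin

abbreviation "m \<equiv> fs_machines I"

definition starts :: "(nat \<Rightarrow> nat) \<Rightarrow> nat \<Rightarrow> nat set" where
  "starts y j = {\<tau>. fs_decision I p y \<tau> = Some j}"

lemma m_pos: "1 \<le> m"
  using valid by (simp add: fs_valid_def)

lemma decision_job:
  "y \<in> set_pmf (fs_law I) \<Longrightarrow> fs_decision I p y \<tau> = Some j \<Longrightarrow> j \<in> {1..fs_jobs I}"
  using policy by (auto simp: fs_policy_def)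

lemma starts_apart:
  "y \<in> set_pmf (fs_law I) \<Longrightarrow> s \<in> starts y j \<Longrightarrow> \<tau> \<in> starts y j \<Longrightarrow> s < \<tau> \<Longrightarrow> s + m \<le> \<tau>"
  using policy by (auto simp: fs_policy_def starts_def)

text \<open>Loops of one job start at least \<open>m\<close> apart, and \<open>m\<close> time steps
  advance the slot by exactly one. Hence no two loops of a job share a slot.\<close>

lemma strict_mono_on_slot:
  assumes "y \<in> set_pmf (fs_law I)" and "1 \<le> k"
  shows "strict_mono_on (starts y j) (slot m k)"
proof (rule strict_mono_onI)
  fix s \<tau> assume "s \<in> starts y j" "\<tau> \<in> starts y j" "s < \<tau>"
  then have "s + m \<le> \<tau>" using starts_apart assms by blast
  then have "slot m k (s + m) \<le> slot m k \<tau>" by (rule slot_mono)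
  then show "slot m k s < slot m k \<tau>" using slot_add[OF m_pos assms(2)] by simp
qed

section \<open>Completion times in the flow shop and in the auxiliary schedules\<close>

lemma fs_completion_eq:
  "fs_completion I p y j = (INF s\<in>ranked (starts y j) (y j). of_nat (s + m))"
proof -
  have "ranked (starts y j) (y j) = {s. fs_decision I p y s = Some j \<and>
      card {s'. s' \<le> s \<and> fs_decision I p y s' = Some j} = y j}"
    by (simp add: ranked_def starts_def conj_commute)
  then show ?thesis by (simp only: fs_completion_def)
qed

lemma induced_eq_Some_iff_starts:
  assumes "0 \<le> s" and "i \<in> {1..m}" and "k \<in> {1..m}"
  shows "induced_policy I p k (real \<circ> y) i s = Some j \<longleftrightarrow>
    (\<exists>\<tau>\<in>starts y j. \<tau> mod m + 1 = i \<and> slot m k \<tau> = nat \<lfloor>s\<rfloor>)"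
  using induced_policy_eq_Some_iff[OF assms, of p "real \<circ> y" j] by (simp add: starts_def)

text \<open>The slots used by job \<open>j\<close> are the images of its start times, in the same
  order, so its last loop fills its last required slot.\<close>

lemma induced_completion_eq:
  assumes y: "y \<in> set_pmf (fs_law I)" and j: "j \<in> {1..fs_jobs I}" and k: "k \<in> {1..m}"
  shows "ma_completion (aux_instance I k) (induced_policy I p k) (real \<circ> y) j
       = (INF s\<in>ranked (starts y j) (y j). of_nat (slot m k s + 1))"
proof -
  let ?S = "induced_policy I p k (real \<circ> y)"
  have "(\<exists>i\<in>{1..m}. ?S i s = Some j) \<longleftrightarrow> nat \<lfloor>s\<rfloor> \<in> slot m k ` starts y j" if "0 \<le> s" for s
  proof -
    have "\<tau> mod m + 1 \<in> {1..m}" for \<tau>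
      using m_pos mod_less_divisor[of m \<tau>] by (simp add: Suc_le_eq)
    moreover note induced_eq_Some_iff_starts[OF that _ k, of _ y j]
    ultimately have "(\<exists>i\<in>{1..m}. ?S i s = Some j) \<longleftrightarrow> (\<exists>\<tau>\<in>starts y j. slot m k \<tau> = nat \<lfloor>s\<rfloor>)"
      by blast
    also have "\<dots> \<longleftrightarrow> nat \<lfloor>s\<rfloor> \<in> slot m k ` starts y j"
      unfolding image_iff by metis
    finally show ?thesis .
  qed
  then have "{s. 0 \<le> s \<and> s < t \<and> (\<exists>i\<in>{1..m}. ?S i s = Some j)}
      = {s. 0 \<le> s \<and> s < t \<and> nat \<lfloor>s\<rfloor> \<in> slot m k ` starts y j}" for t
    by auto
  then have "ma_completion (aux_instance I k) (induced_policy I p k) (real \<circ> y) j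
     = (INF t\<in>{t. 0 \<le> t \<and> of_nat (y j)
          \<le> emeasure lborel {s. 0 \<le> s \<and> s < t \<and> nat \<lfloor>s\<rfloor> \<in> slot m k ` starts y j}}. ennreal t)"
    by (simp add: ma_completion_def ma_received_def aux_instance_def ennreal_of_nat_eq_real_of_nat)
  also have "\<dots> = (INF a\<in>ranked (slot m k ` starts y j) (y j). of_nat (a + 1))"
    using fs_law_range[OF valid y j] by (rule INF_time_received)
  also have "\<dots> = (INF s\<in>ranked (starts y j) (y j). of_nat (slot m k s + 1))"
    using ranked_image[OF strict_mono_on_slot[OF y]] k by (simp add: image_comp comp_def)
  finally show ?thesis .
qed

text \<open>One set of rank elements, empty or a singleton, governs the completion time in the flow
  shop and in all \<open>m\<close> auxiliary schedules at once.\<close>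

lemma completion_cases:
  assumes "y \<in> set_pmf (fs_law I)" and "j \<in> {1..fs_jobs I}"
  obtains
    (never) "fs_completion I p y j = \<infinity>"
      "\<And>k. k \<in> {1..m} \<Longrightarrow>
        ma_completion (aux_instance I k) (induced_policy I p k) (real \<circ> y) j = \<infinity>"
  | (at) s where "s \<in> ranked (starts y j) (y j)" "fs_completion I p y j = of_nat (s + m)"
      "\<And>k. k \<in> {1..m} \<Longrightarrow>
        ma_completion (aux_instance I k) (induced_policy I p k) (real \<circ> y) j = of_nat (slot m k s + 1)"
proof (cases "ranked (starts y j) (y j) = {}")
  case True
  then show thesis
    using assms by (intro never) (simp_all add: fs_completion_eq induced_completion_eq)
next
  case False
  then obtain s where s: "s \<in> ranked (starts y j) (y j)" by auto
  then have "ranked (starts y j) (y j) = {s}" using ranked_unique by blast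
  then show thesis
    using assms s by (intro at[of s]) (simp_all add: fs_completion_eq induced_completion_eq)
qed

text \<open>The slot numbers of the last start \<open>s\<close> sum to \<open>s\<close>, and the
  \<open>m\<close> slot lengths add the remaining \<open>m\<close>. If the job never finishes, both
  sides are \<infinity> since \<open>m \<ge> 1\<close>.\<close>

lemma fs_completion_eq_sum:
  assumes "y \<in> set_pmf (fs_law I)" and "j \<in> {1..fs_jobs I}"
  shows "fs_completion I p y j =
    (\<Sum>k=1..m. ma_completion (aux_instance I k) (induced_policy I p k) (real \<circ> y) j)"
  using assms
proof (cases rule: completion_cases)
  case never
  then show ?thesis using m_pos by (simp add: ennreal_mult_top)
next
  case (at s)
  have "(\<Sum>k=1..m. ma_completion (aux_instance I k) (induced_policy I p k) (real \<circ> y) j)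
      = (\<Sum>k=1..m. of_nat (slot m k s + 1))"
    using at by (intro sum.cong) auto
  also have "\<dots> = of_nat (\<Sum>k=1..m. slot m k s + 1)" by (rule of_nat_sum[symmetric])
  also have "(\<Sum>k=1..m. slot m k s + 1) = s + m"
    using sum_slot[OF m_pos] by (simp only: sum.distrib) simp
  finally show ?thesis using at(2) by (simp only:)
qed

text \<open>Needed for the makespan: by monotonicity of \<open>slot\<close>, a job that is last in
  the flow shop is last under every induced policy.\<close>

lemma induced_completion_mono:
  assumes y: "y \<in> set_pmf (fs_law I)" and j: "j \<in> {1..fs_jobs I}" "j' \<in> {1..fs_jobs I}"
    and k: "k \<in> {1..m}" and le: "fs_completion I p y j \<le> fs_completion I p y j'"
  shows "ma_completion (aux_instance I k) (induced_policy I p k) (real \<circ> y) j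
       \<le> ma_completion (aux_instance I k) (induced_policy I p k) (real \<circ> y) j'"
  using y j(2)
proof (cases rule: completion_cases)
  case never
  then show ?thesis using k by simp
next
  case s': (at s')
  from y j(1) show ?thesis
  proof (cases rule: completion_cases)
    case never
    then show ?thesis using le s' by (simp add: top_unique)
  next
    case (at s)
    then have "(of_nat (s + m) :: ennreal) \<le> of_nat (s' + m)" using s' le by metis
    then have "s \<le> s'" by (simp only: of_nat_le_iff add_le_cancel_right)
    then have "slot m k s + 1 \<le> slot m k s' + 1" using slot_mono by simp
    then have "(of_nat (slot m k s + 1) :: ennreal) \<le> of_nat (slot m k s' + 1)"
      by (simp only: of_nat_le_iff)
    then show ?thesis using at s' k by simp
  qed
qed

section \<open>Decomposition of the objective and of its expectation\<close>

lemma objective_value_eq_sum: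
  assumes y: "y \<in> set_pmf (fs_law I)"
  shows "objective_value \<gamma> (fs_jobs I) (fs_weight I) (fs_completion I p y) =
    (\<Sum>k=1..m. objective_value \<gamma> (fs_jobs I) (fs_weight I)
       (ma_completion (aux_instance I k) (induced_policy I p k) (real \<circ> y)))"
proof (cases \<gamma>)
  case Total_Completion
  then show ?thesis
    using fs_completion_eq_sum[OF y] by (simp only: objective_value.simps cong: sum.cong) (rule sum.swap)
next
  case Weighted_Completion
  then show ?thesis
    using fs_completion_eq_sum[OF y]
    by (simp only: objective_value.simps sum_distrib_left cong: sum.cong) (rule sum.swap)
next
  case Makespan
  let ?J = "{1..fs_jobs I}"
  let ?C = "fs_completion I p y"
  let ?D = "\<lambda>k. ma_completion (aux_instance I k) (induced_policy I p k) (real \<circ> y)"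
  have "?J \<noteq> {}" using valid by (simp add: fs_valid_def)
  then have "Max (?C ` ?J) \<in> ?C ` ?J" by (intro Max_in) auto
  \<comment> \<open>In general a maximum of sums is not the sum of the maxima; here this single job
    \<open>j\<close> attains the maximum in the flow shop and for every \<open>k\<close>.\<close>
  then obtain j where j: "j \<in> ?J" "Max (?C ` ?J) = ?C j" by auto
  then have le: "?C j' \<le> ?C j" if "j' \<in> ?J" for j'
    using that by (metis Max_ge finite_atLeastAtMost finite_imageI imageI)
  have "Max (?D k ` ?J) = ?D k j" if "k \<in> {1..m}" for k
    using induced_completion_mono[OF y _ j(1) that le] j(1) by (intro Max_eqI) auto
  then show ?thesis
    using Makespan j fs_completion_eq_sum[OF y j(1)] by simp
qed

lemma fs_cost_eq_sum:
  "fs_cost \<gamma> I p = (\<Sum>k=1..m. ma_cost \<gamma> (aux_instance I k) (induced_policy I p k))"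
proof -
  have "fs_cost \<gamma> I p = (\<integral>\<^sup>+ y. (\<Sum>k=1..m. objective_value \<gamma> (fs_jobs I) (fs_weight I)
       (ma_completion (aux_instance I k) (induced_policy I p k) (real \<circ> y))) \<partial>measure_pmf (fs_law I))"
    unfolding fs_cost_def
    by (intro nn_integral_cong_AE AE_pmfI objective_value_eq_sum)
  also have "\<dots> = (\<Sum>k=1..m. \<integral>\<^sup>+ y. objective_value \<gamma> (fs_jobs I) (fs_weight I)
       (ma_completion (aux_instance I k) (induced_policy I p k) (real \<circ> y)) \<partial>measure_pmf (fs_law I))"
    by (intro nn_integral_sum) simp
  also have "\<dots> = (\<Sum>k=1..m. ma_cost \<gamma> (aux_instance I k) (induced_policy I p k))"
    by (simp add: ma_cost_def aux_law nn_integral_map_pmf) (simp add: aux_instance_def)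
  finally show ?thesis .
qed

section \<open>Feasibility and non-anticipativity of the induced policies\<close>

lemma induced_feasible:
  assumes y: "y \<in> set_pmf (fs_law I)" and k: "k \<in> {1..m}"
  shows "ma_feasible (aux_instance I k) (induced_policy I p k (real \<circ> y))"
proof -
  let ?S = "induced_policy I p k (real \<circ> y)"
  let ?a = "aux_arrival m k"
  note iff = induced_eq_Some_iff_starts[OF _ _ k, of _ _ y]
  have "?a i \<le> s" if "?S i s = Some j" for i s j
    using that by (auto simp: induced_policy_def Let_def split: if_splits)
  moreover have "j \<in> {1..fs_jobs I}" if "i \<in> {1..m}" "0 \<le> s" "?S i s = Some j" for i s j
    using iff[OF that(2,1)] that(3) decision_job[OF y] unfolding starts_def by blast
  moreover have "i' = i"
    if i: "i \<in> {1..m}" "i' \<in> {1..m}" and s: "0 \<le> s" and S: "?S i s = Some j" "?S i' s = Some j"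
    for i i' s j
  proof -
    obtain \<tau> where \<tau>: "\<tau> \<in> starts y j" "\<tau> mod m + 1 = i" "slot m k \<tau> = nat \<lfloor>s\<rfloor>"
      using iff[OF s i(1)] S(1) by blast
    obtain \<tau>' where \<tau>': "\<tau>' \<in> starts y j" "\<tau>' mod m + 1 = i'" "slot m k \<tau>' = nat \<lfloor>s\<rfloor>"
      using iff[OF s i(2)] S(2) by blast
    \<comment> \<open>Two machines working on \<open>j\<close> at once would need two of its loops
      in the same slot.\<close>
    have "inj_on (slot m k) (starts y j)"
      using strict_mono_on_slot[OF y] k by (intro strict_mono_on_imp_inj_on) simp
    then have "\<tau> = \<tau>'" using \<tau> \<tau>' by (metis inj_onD)
    then show ?thesis using \<tau> \<tau>' by simp
  qed
  moreover have "{s. 0 \<le> s \<and> ?S i s = Some j} \<in> sets borel" if "i \<in> {1..m}" for i j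
  proof -
    \<comment> \<open>Each job occupies a machine during a union of unit slots, which is a Borel
      set.\<close>
    have "{s. 0 \<le> s \<and> ?S i s = Some j}
        = {s. 0 \<le> s \<and> nat \<lfloor>s\<rfloor> \<in> slot m k ` {\<tau> \<in> starts y j. \<tau> mod m + 1 = i}}"
    proof (rule Collect_cong, rule conj_cong[OF refl])
      fix s :: real assume "0 \<le> s"
      then show "?S i s = Some j \<longleftrightarrow> nat \<lfloor>s\<rfloor> \<in> slot m k ` {\<tau> \<in> starts y j. \<tau> mod m + 1 = i}"
        unfolding iff[OF \<open>0 \<le> s\<close> that] image_iff by (metis (mono_tags, lifting) mem_Collect_eq)
    qed
    then show ?thesis using slots_borel by simp
  qed
  ultimately show ?thesis
    unfolding ma_feasible_def aux_instance_def ma_instance.simps by blast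
qed

text \<open>Causality: a loop finished by \<tau> started at some \<open>s\<close> with
  \<open>s + m \<le> \<tau>\<close>, so its slot ends at or before the beginning of the slot of
  \<tau>. Thus every completion seen by the flow shop policy has already occurred in the auxiliary
  schedule.\<close>

lemma completed_induced_completion:
  assumes y: "y \<in> set_pmf (fs_law I)" and k: "k \<in> {1..m}"
    and j: "j \<in> fs_completed I y (fs_history I p y \<tau>)"
  shows "ma_completion (aux_instance I k) (induced_policy I p k) (real \<circ> y) j
       \<le> of_nat (slot m k \<tau>)"
proof -
  have job: "j \<in> {1..fs_jobs I}" and le: "y j \<le> card {s. s + m \<le> \<tau> \<and> s \<in> starts y j}"
    using j by (auto simp: fs_completed_history[OF m_pos] starts_def)
  have "{s. s + m \<le> \<tau> \<and> s \<in> starts y j} = {s \<in> starts y j. s < \<tau> + 1 - m}"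
    using m_pos by auto
  then obtain s where s: "s \<in> ranked (starts y j) (y j)" "s < \<tau> + 1 - m"
    using ranked_exists fs_law_range[OF valid y job] le by metis
  have "ma_completion (aux_instance I k) (induced_policy I p k) (real \<circ> y) j
      \<le> of_nat (slot m k s + 1)"
    unfolding induced_completion_eq[OF y job k] using s(1) by (rule INF_lower)
  also have "slot m k s + 1 = slot m k (s + m)" using slot_add[OF m_pos] k by simp
  also have "of_nat \<dots> \<le> (of_nat (slot m k \<tau>) :: ennreal)"
    unfolding of_nat_le_iff using s(2) by (intro slot_mono) simp
  finally show ?thesis .
qed

text \<open>For realizations that look alike up to \<open>t\<close>, induction on \<tau> shows equal
  histories at all times whose slot begins by \<open>t\<close>: equal histories give equal sets of
  completed jobs, hence the same next decision.\<close>

lemma induced_nonanticipatory: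
  assumes k: "k \<in> {1..m}"
  shows "ma_nonanticipatory (aux_instance I k) (induced_policy I p k)"
proof -
  let ?C = "\<lambda>y. ma_completion (aux_instance I k) (induced_policy I p k) (real \<circ> y)"
  \<comment> \<open>Implied by the relation in \<open>ma_nonanticipatory\<close> and symmetric in
    \<open>y\<close> and \<open>y'\<close>, so one inclusion between the sets of completed jobs
    gives both.\<close>
  define indist where "indist t y y' \<longleftrightarrow> (\<forall>j\<in>{1..fs_jobs I}.
      y j = y' j \<or> (ennreal t < ?C y j \<and> ennreal t < ?C y' j))" for t and y y' :: "nat \<Rightarrow> nat"
  have subset: "fs_completed I y (fs_history I p y \<tau>) \<subseteq> fs_completed I y' (fs_history I p y' \<tau>)"
    if y: "y \<in> set_pmf (fs_law I)" and ind: "indist t y y'" and \<tau>: "real (slot m k \<tau>) \<le> t"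
      and eq: "fs_history I p y \<tau> = fs_history I p y' \<tau>" for t \<tau> y y'
  proof
    fix j assume j: "j \<in> fs_completed I y (fs_history I p y \<tau>)"
    have "?C y j \<le> of_nat (slot m k \<tau>)" using completed_induced_completion[OF y k j] .
    also have "\<dots> \<le> ennreal t"
      unfolding ennreal_of_nat_eq_real_of_nat using \<tau> by (rule ennreal_leI)
    \<comment> \<open>Job \<open>j\<close> is complete by \<open>t\<close> under \<open>y\<close>,
      which excludes the second alternative of \<open>indist\<close>.\<close>
    finally have "y j = y' j"
      using ind j by (auto simp: indist_def fs_completed_def)
    then show "j \<in> fs_completed I y' (fs_history I p y' \<tau>)"
      using j eq by (simp add: fs_completed_def)
  qed
  have completed: "fs_completed I y (fs_history I p y \<tau>) = fs_completed I y' (fs_history I p y' \<tau>)"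
    if "y \<in> set_pmf (fs_law I)" "y' \<in> set_pmf (fs_law I)" "indist t y y'" "real (slot m k \<tau>) \<le> t"
      "fs_history I p y \<tau> = fs_history I p y' \<tau>" for t \<tau> y y'
  proof -
    have "indist t y' y" using that(3) by (auto simp: indist_def)
    then show ?thesis using subset that by (intro antisym) metis+
  qed
  have history: "fs_history I p y \<tau> = fs_history I p y' \<tau>"
    if "y \<in> set_pmf (fs_law I)" "y' \<in> set_pmf (fs_law I)" "indist t y y'" "real (slot m k \<tau>) \<le> t"
    for t \<tau> y y'
    using that(4)
  proof (induction \<tau>)
    case (Suc \<tau>)
    have "real (slot m k \<tau>) \<le> t"
      using slot_mono[of \<tau> "Suc \<tau>" m k] Suc.prems by simp
    then show ?case using Suc.IH completed[OF that(1-3)] by simp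
  qed simp
  have decision: "fs_decision I p y \<tau> = fs_decision I p y' \<tau>"
    if "y \<in> set_pmf (fs_law I)" "y' \<in> set_pmf (fs_law I)" "indist t y y'" "real (slot m k \<tau>) \<le> t"
    for t \<tau> y y'
    using history[OF that] completed[OF that] by (simp add: fs_decision_def)
  have same: "induced_policy I p k (real \<circ> y) i t = induced_policy I p k (real \<circ> y') i t"
    if y: "y \<in> set_pmf (fs_law I)" "y' \<in> set_pmf (fs_law I)" and "0 \<le> t" "indist t y y'"
      and i: "i \<in> {1..m}" for y y' t i
  proof -
    \<comment> \<open>All machines at time \<open>t\<close> execute decisions of slot
      \<open>nat \<lfloor>t\<rfloor>\<close>, which begins no later than \<open>t\<close>.\<close>
    have "\<tau> \<in> starts y j \<longleftrightarrow> \<tau> \<in> starts y' j" if "slot m k \<tau> = nat \<lfloor>t\<rfloor>" for \<tau> j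
      using decision[OF y \<open>indist t y y'\<close>] that \<open>0 \<le> t\<close> by (simp add: starts_def)
    then have "induced_policy I p k (real \<circ> y) i t = Some j \<longleftrightarrow>
               induced_policy I p k (real \<circ> y') i t = Some j" for j
      unfolding induced_eq_Some_iff_starts[OF \<open>0 \<le> t\<close> i k] by blast
    then show ?thesis by (metis option.exhaust)
  qed
  have aux: "ma_machines (aux_instance I k) = m" "ma_jobs (aux_instance I k) = fs_jobs I"
    by (simp_all add: aux_instance_def)
  show ?thesis
    unfolding ma_nonanticipatory_def aux_law aux
  proof (intro ballI allI impI)
    fix x x' and t :: real and i
    assume x: "x \<in> set_pmf (map_pmf (\<lambda>y. real \<circ> y) (fs_law I))"
      "x' \<in> set_pmf (map_pmf (\<lambda>y. real \<circ> y) (fs_law I))"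
      and t: "0 \<le> t" and i: "i \<in> {1..m}"
      and ind: "\<forall>j\<in>{1..fs_jobs I}.
        (x j = x' j \<and> ma_completion (aux_instance I k) (induced_policy I p k) x j =
           ma_completion (aux_instance I k) (induced_policy I p k) x' j) \<or>
        (ennreal t < ma_completion (aux_instance I k) (induced_policy I p k) x j \<and>
         ennreal t < ma_completion (aux_instance I k) (induced_policy I p k) x' j)"
    obtain y y' where y: "y \<in> set_pmf (fs_law I)" "y' \<in> set_pmf (fs_law I)"
      and xy: "x = real \<circ> y" "x' = real \<circ> y'"
      using x by auto
    have "indist t y y'" using ind by (auto simp: indist_def xy)
    then show "induced_policy I p k x i t = induced_policy I p k x' i t"
      unfolding xy using y t i by (intro same)
  qed
qed

text \<open>Arrival times are 0 or 1, so the induced policy is constant on unit slots and is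
  admissible under either preemption mode.\<close>

lemma induced_policy_ma_policy:
  assumes "k \<in> {1..m}"
  shows "ma_policy \<mu> (aux_instance I k) (induced_policy I p k)"
proof -
  have "induced_policy I p k x i s = induced_policy I p k x i (of_int \<lfloor>s\<rfloor>)" if "0 \<le> s" for x i s
    using that by (simp add: induced_policy_floor)
  moreover have "ma_feasible (aux_instance I k) (induced_policy I p k x)"
    if "x \<in> set_pmf (ma_law (aux_instance I k))" for x
    using that induced_feasible[OF _ assms] by (auto simp: aux_law)
  ultimately show ?thesis
    using induced_nonanticipatory[OF assms] unfolding ma_policy_def by blast
qed

text \<open>Each summand of the cost of \<open>p\<close> is the cost of an admissible policy for its
  auxiliary instance, hence at least that optimum.\<close>

lemma sum_ma_opt_le: "(\<Sum>k=1..m. ma_opt \<mu> \<gamma> (aux_instance I k)) \<le> fs_cost \<gamma> I p"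
  unfolding fs_cost_eq_sum ma_opt_def
  using induced_policy_ma_policy by (intro sum_mono INF_lower) auto

end

theorem theorem3:
  fixes \<gamma> :: objective and \<alpha> :: real and \<pi> :: "fs_instance \<Rightarrow> fs_decision_rule"
    and \<mu> :: preemption
  assumes "1 \<le> \<alpha>"
    and "\<And>I. fs_valid I \<Longrightarrow> fs_policy I (\<pi> I)"
    and "\<And>I k. fs_valid I \<Longrightarrow> k \<in> {1..fs_machines I} \<Longrightarrow>
           ma_cost \<gamma> (aux_instance I k) (induced_policy I (\<pi> I) k)
             \<le> ennreal \<alpha> * ma_opt \<mu> \<gamma> (aux_instance I k)"
  shows "fs_approximation \<gamma> \<alpha> \<pi>"
  unfolding fs_approximation_def
proof (intro allI impI conjI)
  fix I assume valid: "fs_valid I"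
  show policy: "fs_policy I (\<pi> I)" using assms(2) valid .
  \<comment> \<open>The bound holds for every flow shop policy, so it passes to the infimum.\<close>
  have lower: "(\<Sum>k=1..fs_machines I. ma_opt \<mu> \<gamma> (aux_instance I k)) \<le> fs_opt \<gamma> I"
    unfolding fs_opt_def
    using reentry_policy.sum_ma_opt_le valid by (intro INF_greatest) (simp add: reentry_policy_def)
  have "fs_cost \<gamma> I (\<pi> I)
      = (\<Sum>k=1..fs_machines I. ma_cost \<gamma> (aux_instance I k) (induced_policy I (\<pi> I) k))"
    using valid policy by (intro reentry_policy.fs_cost_eq_sum) (simp add: reentry_policy_def)
  also have "\<dots> \<le> (\<Sum>k=1..fs_machines I. ennreal \<alpha> * ma_opt \<mu> \<gamma> (aux_instance I k))"
    using assms(3) valid by (intro sum_mono) auto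
  also have "\<dots> \<le> ennreal \<alpha> * fs_opt \<gamma> I"
    unfolding sum_distrib_left[symmetric] using lower by (rule mult_left_mono) simp
  finally show "fs_cost \<gamma> I (\<pi> I) \<le> ennreal \<alpha> * fs_opt \<gamma> I" .
qed

end
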